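(* Let $\mu>0$ be a constant and let $f\colon[0,\infty)\to\mathbb{R}$ be such that the integrals $$\int_0^\infty\sin(\mu s)f(s)\,ds,\qquad \int_0^\infty\cos(\mu s)f(s)\,ds$$ are convergent in the Riemann sense. Let $y$ satisfy the equation $$y''(t)+\mu^2y(t)=f(t)\quad\text{for }t\ge 0.$$ Then $\lim_{t\to\infty}y(t)=0$ if and only if $$y(0)=\frac1\mu\int_0^\infty\sin(\mu s)f(s)\,ds\quad\text{and}\quad y'(0)=-\int_0^\infty\cos(\mu s)f(s)\,ds.$$
   Context: The equation is the non-homogeneous harmonic oscillator equation, an ordinary differential equation for a real function $y$ on $[0,\infty)$, with the constant $\mu>0$ and the function $f$ given. Convergence in the Riemann sense refers to convergence as improper Riemann integrals over $[0,\infty)$. *)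

theory Defs
  imports "HOL-Analysis.Henstock_Kurzweil_Integration"
begin

text \<open>
  The library integral is the Henstock-Kurzweil integral, whose class of integrable functions is
  strictly larger than that of the Riemann integral.  The Riemann integral proper asks for a uniform
  bound on the mesh of the tagged division instead of a gauge; for a real interval
  \<^term>\<open>content K\<close> is its length.
\<close>

definition has_riemann_integral :: "(real \<Rightarrow> real) \<Rightarrow> real \<Rightarrow> real \<Rightarrow> real \<Rightarrow> bool"
  where "has_riemann_integral g I a b \<longleftrightarrow>
    (\<forall>e>0. \<exists>d>0. \<forall>p. p tagged_division_of {a..b} \<and> (\<forall>(x, K)\<in>p. content K < d) \<longrightarrow>
      \<bar>(\<Sum>(x, K)\<in>p. content K * g x) - I\<bar> < e)"

text \<open>Improper Riemann integral over \<^term>\<open>{0..}\<close>; the only improper point is infinity.\<close>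

definition has_improper_riemann_integral :: "(real \<Rightarrow> real) \<Rightarrow> real \<Rightarrow> bool"
  where "has_improper_riemann_integral g I \<longleftrightarrow>
    (\<exists>G. (\<forall>T\<ge>0. has_riemann_integral g (G T) 0 T) \<and> (G \<longlongrightarrow> I) at_top)"

definition improper_riemann_convergent :: "(real \<Rightarrow> real) \<Rightarrow> bool"
  where "improper_riemann_convergent g \<longleftrightarrow> (\<exists>I. has_improper_riemann_integral g I)"

definition improper_riemann_integral :: "(real \<Rightarrow> real) \<Rightarrow> real"
  where "improper_riemann_integral g = (THE I. has_improper_riemann_integral g I)"

lemma has_riemann_integral_imp_has_integral:
  assumes "has_riemann_integral g I a b"
  shows "(g has_integral I) {a..b}"
  unfolding has_integral_real
proof (intro allI impI)
  fix e :: real assume "e > 0"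
  then obtain d where d: "d > 0" and D: "\<And>p. p tagged_division_of {a..b} \<Longrightarrow>
      (\<And>x K. (x, K) \<in> p \<Longrightarrow> content K < d) \<Longrightarrow> \<bar>(\<Sum>(x, K)\<in>p. content K * g x) - I\<bar> < e"
    using assms unfolding has_riemann_integral_def by (metis (no_types, lifting) case_prodI2)
  show "\<exists>\<gamma>. gauge \<gamma> \<and> (\<forall>\<D>. \<D> tagged_division_of {a..b} \<and> \<gamma> fine \<D> \<longrightarrow>
      norm ((\<Sum>(x, K)\<in>\<D>. content K *\<^sub>R g x) - I) < e)"
  proof (intro exI[of _ "\<lambda>x. ball x (d / 2)"] conjI allI impI)
    show "gauge (\<lambda>x. ball x (d / 2))"
      using d by (intro gauge_ball) simp
    fix p assume p: "p tagged_division_of {a..b} \<and> (\<lambda>x. ball x (d / 2)) fine p"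
    have "content K < d" if xK: "(x, K) \<in> p" for x K
    proof -
      obtain u v where K: "K = {u..v}"
        using p xK tagged_division_ofD(4) by (metis box_real(2))
      have "x \<in> K"
        using p xK tagged_division_ofD(2) by blast
      then have uv: "u \<le> v" using K by simp
      have "K \<subseteq> ball x (d / 2)"
        using p xK by (auto simp: fine_def)
      then have "u \<in> ball x (d / 2)" "v \<in> ball x (d / 2)"
        using K uv by auto
      then have "v - u < d"
        by (auto simp: dist_real_def abs_if split: if_splits)
      then show ?thesis using K uv by simp
    qed
    then show "norm ((\<Sum>(x, K)\<in>p. content K *\<^sub>R g x) - I) < e"
      using D p by auto
  qed
qed

lemma has_improper_riemann_integral_unique:
  assumes "has_improper_riemann_integral g I" "has_improper_riemann_integral g J"
  shows "I = J"
proof -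
  obtain G H where G: "\<And>T. T \<ge> 0 \<Longrightarrow> has_riemann_integral g (G T) 0 T" "(G \<longlongrightarrow> I) at_top"
    and H: "\<And>T. T \<ge> 0 \<Longrightarrow> has_riemann_integral g (H T) 0 T" "(H \<longlongrightarrow> J) at_top"
    using assms unfolding has_improper_riemann_integral_def by blast
  have "G T = H T" if "T \<ge> 0" for T
    using has_riemann_integral_imp_has_integral G(1) H(1) that has_integral_unique by blast
  then have "\<forall>\<^sub>F T in at_top. G T = H T"
    by (meson eventually_at_top_linorder)
  then have "(H \<longlongrightarrow> I) at_top"
    using G(2) tendsto_cong by blast
  then show ?thesis
    using H(2) by (metis tendsto_unique trivial_limit_at_top_linorder)
qed

lemma improper_riemann_integral_eqI:
  "has_improper_riemann_integral g I \<Longrightarrow> improper_riemann_integral g = I"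
  unfolding improper_riemann_integral_def
  using has_improper_riemann_integral_unique by blast

end

theory Submission
  imports Defs
begin

text \<open>
  The proof is variation of parameters.  Along a solution put
  \<open>c t = cos (\<mu> * t) * y' t + \<mu> * sin (\<mu> * t) * y t\<close> and
  \<open>s t = sin (\<mu> * t) * y' t - \<mu> * cos (\<mu> * t) * y t\<close>, the coordinates of \<open>(y', \<mu> * y)\<close> in a frame
  that rotates with the unforced oscillator.  They are constant when \<open>f\<close> vanishes, and in general
  the equation gives \<open>c' t = cos (\<mu> * t) * f t\<close> and \<open>s' t = sin (\<mu> * t) * f t\<close>.  By the fundamental
  theorem of calculus the two convergence hypotheses therefore give \<open>c\<close> and \<open>s\<close>
  limits \<open>A\<close> and \<open>B\<close> at infinity, where \<open>A\<close> is \<open>y' 0\<close> plus the cosine integral and \<open>B\<close> is the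
  sine integral minus \<open>\<mu> * y 0\<close> (lemma \<open>tendsto_of_derivative_improper_integral\<close>).

  Rotating back, \<open>\<mu> * y t = sin (\<mu> * t) * c t - cos (\<mu> * t) * s t\<close>, so \<open>\<mu> * y\<close> differs from the
  sinusoid \<open>A * sin (\<mu> * t) - B * cos (\<mu> * t)\<close> by a function tending to zero.  A sinusoid tends to
  zero only if both amplitudes vanish (lemma \<open>sinusoid_tendsto_0_iff\<close>), and \<open>A = B = 0\<close> is the
  asserted pair of initial conditions.
\<close>

text \<open>
  The derivative \<open>g\<close> may be discontinuous; the fundamental theorem for the Henstock-Kurzweil integral
  still applies, and that integral agrees with the Riemann integral wherever the latter exists.
\<close>

lemma tendsto_of_derivative_improper_integral:
  fixes F g :: "real \<Rightarrow> real"
  assumes "has_improper_riemann_integral g I"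
    and deriv: "\<And>t. t \<ge> 0 \<Longrightarrow> (F has_real_derivative g t) (at t within {0..})"
  shows "(F \<longlongrightarrow> F 0 + I) at_top"
proof -
  obtain G where G: "\<And>T. T \<ge> 0 \<Longrightarrow> has_riemann_integral g (G T) 0 T" and lim: "(G \<longlongrightarrow> I) at_top"
    using assms(1) unfolding has_improper_riemann_integral_def by blast
  have "F 0 + G T = F T" if "T \<ge> 0" for T
  proof -
    have "(g has_integral (F T - F 0)) {0..T}"
    proof (rule fundamental_theorem_of_calculus[OF that])
      fix x assume "x \<in> {0..T}"
      then have "(F has_real_derivative g x) (at x within {0..T})"
        by (intro DERIV_subset[OF deriv]) auto
      then show "(F has_vector_derivative g x) (at x within {0..T})"
        by (simp add: has_real_derivative_iff_has_vector_derivative)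
    qed
    moreover have "(g has_integral G T) {0..T}"
      using G[OF that] by (rule has_riemann_integral_imp_has_integral)
    ultimately have "F T - F 0 = G T"
      by (rule has_integral_unique)
    then show ?thesis by simp
  qed
  then have "\<forall>\<^sub>F T in at_top. F 0 + G T = F T"
    by (meson eventually_at_top_linorder)
  moreover have "((\<lambda>T. F 0 + G T) \<longlongrightarrow> F 0 + I) at_top"
    by (intro tendsto_intros lim)
  ultimately show ?thesis
    by (rule Lim_transform_eventually[rotated])
qed

lemma sinusoid_tendsto_0_iff:
  fixes \<mu> A B :: real
  assumes "\<mu> > 0"
  shows "((\<lambda>t. A * sin (\<mu> * t) - B * cos (\<mu> * t)) \<longlongrightarrow> 0) at_top \<longleftrightarrow> A = 0 \<and> B = 0"
proof
  assume lim: "((\<lambda>t. A * sin (\<mu> * t) - B * cos (\<mu> * t)) \<longlongrightarrow> 0) at_top"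
  \<comment> \<open>Sampling at a fixed phase \<open>\<theta>\<close>, one point per period, turns the sinusoid into a constant
    sequence; the phases \<open>pi / 2\<close> and \<open>0\<close> isolate the two amplitudes.\<close>
  have sample: "A * sin \<theta> - B * cos \<theta> = 0" for \<theta> :: real
  proof -
    have "filterlim (\<lambda>n. \<theta> / \<mu> + 2 * pi / \<mu> * real n) at_top sequentially"
      using assms
      by (intro filterlim_tendsto_add_at_top[OF tendsto_const]
          filterlim_tendsto_pos_mult_at_top[OF tendsto_const] filterlim_real_sequentially) simp
    then have "filterlim (\<lambda>n. (\<theta> + 2 * pi * real n) / \<mu>) at_top sequentially"
      by (simp add: add_divide_distrib)
    from filterlim_compose[OF lim this]
    have "(\<lambda>n. A * sin (\<theta> + 2 * pi * real n) - B * cos (\<theta> + 2 * pi * real n)) \<longlonglongrightarrow> 0"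
      using assms by simp
    moreover have "sin (\<theta> + 2 * pi * real n) = sin \<theta>" "cos (\<theta> + 2 * pi * real n) = cos \<theta>" for n
      using sin_cos_eq_iff[of "\<theta> + 2 * pi * real n" \<theta>] by (auto intro!: exI[of _ "int n"])
    ultimately have "(\<lambda>n::nat. A * sin \<theta> - B * cos \<theta>) \<longlonglongrightarrow> 0"
      by simp
    then show ?thesis
      by (simp only: LIMSEQ_const_iff)
  qed
  show "A = 0 \<and> B = 0"
    using sample[of "pi / 2"] sample[of 0] by simp
qed simp

theorem theorem2p1:
  fixes \<mu> :: real and f y y' y'' :: "real \<Rightarrow> real"
  assumes "\<mu> > 0"
    and "improper_riemann_convergent (\<lambda>s. sin (\<mu> * s) * f s)"
    and "improper_riemann_convergent (\<lambda>s. cos (\<mu> * s) * f s)"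
    and "\<And>t. t \<ge> 0 \<Longrightarrow> (y has_real_derivative y' t) (at t within {0..})"
    and "\<And>t. t \<ge> 0 \<Longrightarrow> (y' has_real_derivative y'' t) (at t within {0..})"
    and "\<And>t. t \<ge> 0 \<Longrightarrow> y'' t + \<mu>\<^sup>2 * y t = f t"
  shows "(y \<longlongrightarrow> 0) at_top \<longleftrightarrow>
    y 0 = 1 / \<mu> * improper_riemann_integral (\<lambda>s. sin (\<mu> * s) * f s) \<and>
    y' 0 = - improper_riemann_integral (\<lambda>s. cos (\<mu> * s) * f s)"
proof -
  define c where "c t = cos (\<mu> * t) * y' t + \<mu> * sin (\<mu> * t) * y t" for t
  define s where "s t = sin (\<mu> * t) * y' t - \<mu> * cos (\<mu> * t) * y t" for t
  let ?S = "improper_riemann_integral (\<lambda>s. sin (\<mu> * s) * f s)"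
  let ?C = "improper_riemann_integral (\<lambda>s. cos (\<mu> * s) * f s)"
  let ?A = "y' 0 + ?C" and ?B = "?S - \<mu> * y 0"

  have S: "has_improper_riemann_integral (\<lambda>s. sin (\<mu> * s) * f s) ?S"
    using assms(2) improper_riemann_integral_eqI unfolding improper_riemann_convergent_def by metis
  have C: "has_improper_riemann_integral (\<lambda>s. cos (\<mu> * s) * f s) ?C"
    using assms(3) improper_riemann_integral_eqI unfolding improper_riemann_convergent_def by metis

  have "(c has_real_derivative cos (\<mu> * t) * f t) (at t within {0..})" if t: "t \<ge> 0" for t
    unfolding c_def using assms(6)[OF t, symmetric]
    by (auto intro!: derivative_eq_intros assms(4)[OF t] assms(5)[OF t]
        simp: algebra_simps power2_eq_square)
  from tendsto_of_derivative_improper_integral[OF C this]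
  have c_lim: "(c \<longlongrightarrow> ?A) at_top"
    by (simp add: c_def)

  have "(s has_real_derivative sin (\<mu> * t) * f t) (at t within {0..})" if t: "t \<ge> 0" for t
    unfolding s_def using assms(6)[OF t, symmetric]
    by (auto intro!: derivative_eq_intros assms(4)[OF t] assms(5)[OF t]
        simp: algebra_simps power2_eq_square)
  from tendsto_of_derivative_improper_integral[OF S this]
  have s_lim: "(s \<longlongrightarrow> ?B) at_top"
    by (simp add: s_def)

  have rotate_back: "\<mu> * y t = sin (\<mu> * t) * c t - cos (\<mu> * t) * s t" for t
  proof -
    have "sin (\<mu> * t) * c t - cos (\<mu> * t) * s t
        = \<mu> * y t * ((sin (\<mu> * t))\<^sup>2 + (cos (\<mu> * t))\<^sup>2)"
      unfolding c_def s_def by algebra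
    then show ?thesis by simp
  qed

  have zero_bounded: "((\<lambda>t. b t * h t) \<longlongrightarrow> 0) at_top"
    if "(h \<longlongrightarrow> 0) at_top" "\<And>t. \<bar>b t\<bar> \<le> 1" for b h :: "real \<Rightarrow> real"
  proof (rule Lim_null_comparison)
    show "\<forall>\<^sub>F t in at_top. norm (b t * h t) \<le> \<bar>h t\<bar>"
      using that(2) by (simp add: abs_mult mult_left_le_one_le)
    show "((\<lambda>t. \<bar>h t\<bar>) \<longlongrightarrow> 0) at_top"
      using that(1) by (rule tendsto_rabs_zero)
  qed
  have "((\<lambda>t. sin (\<mu> * t) * (c t - ?A) - cos (\<mu> * t) * (s t - ?B)) \<longlongrightarrow> 0 - 0) at_top"
    by (rule tendsto_diff[OF zero_bounded[OF LIM_zero[OF c_lim] abs_sin_le_one]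
          zero_bounded[OF LIM_zero[OF s_lim] abs_cos_le_one]])
  then have diff: "((\<lambda>t. \<mu> * y t - (?A * sin (\<mu> * t) - ?B * cos (\<mu> * t))) \<longlongrightarrow> 0) at_top"
    by (simp add: rotate_back algebra_simps)

  have "(y \<longlongrightarrow> 0) at_top \<longleftrightarrow> ((\<lambda>t. \<mu> * y t) \<longlongrightarrow> 0) at_top"
    using tendsto_mult_left_iff[of \<mu> y 0 at_top] assms(1) by simp
  also have "\<dots> \<longleftrightarrow> ((\<lambda>t. ?A * sin (\<mu> * t) - ?B * cos (\<mu> * t)) \<longlongrightarrow> 0) at_top"
    using Lim_transform_eq[OF diff] .
  also have "\<dots> \<longleftrightarrow> ?A = 0 \<and> ?B = 0"
    by (rule sinusoid_tendsto_0_iff[OF assms(1)])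
  also have "\<dots> \<longleftrightarrow> y 0 = 1 / \<mu> * ?S \<and> y' 0 = - ?C"
    using assms(1) by (auto simp: field_simps)
  finally show ?thesis .
qed

end
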